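(* Let $T$ be a normal lax monad on a thin equipment $\mathcal K$. Let $A$, $B$ and $M$ be $T$-graphs, $d\colon A\to M$ a $T$-morphism and $J\colon A\nrightarrow B$ a $T$-closed horizontal morphism. The left Kan extension $l\colon B\to M$ of $d$ along $J$ in $\mathcal K$, if it exists, is a $T$-morphism whenever it satisfies the Beck–Chevalley condition and $T(d^* )\odot TJ=T(d^*\odot J)$. Moreover, in that case $l$ is $T$-open as soon as both $d$ and $J$ are $T$-open.
   Context: A thin equipment $\mathcal K$ consists of two categories on the same collection of objects: one with composition $\circ$ and identities $\mathrm{id}$, whose morphisms $f\colon A\to C$ are called vertical, and one with composition $\odot$ (written in diagrammatic order) and identities $1_A$, whose morphisms $J\colon A\nrightarrow B$ are called horizontal; together with a collection of cells. A cell has a boundary consisting of a top $J\colon A\nrightarrow B$, a bottom $K\colon C\nrightarrow D$, a left side $f\colon A\to C$ and a right side $g\colon B\to D$, and is uniquely determined by its boundary; write $J\Rightarrow_{f,g}K$ if the cell with this boundary exists. The axioms are: (i) $J\Rightarrow_{f,g}K$ and $K\Rightarrow_{h,k}L$ imply $J\Rightarrow_{h\circ f,k\circ g}L$, and $J\Rightarrow_{f,g}K$ and $H\Rightarrow_{g,l}N$ imply $J\odot H\Rightarrow_{f,l}K\odot N$; (ii) $1_A\Rightarrow_{f,f}1_C$ for all $f\colon A\to C$ and $J\Rightarrow_{\mathrm{id},\mathrm{id}}J$ for all $J$; (iii) writing $J\le K$ for $J\Rightarrow_{\mathrm{id},\mathrm{id}}K$, if $J\le K$ and $K\le J$ then $J=K$;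 (iv) each vertical $f\colon A\to C$ has a companion $f_*\colon A\nrightarrow C$ with $f_*\Rightarrow_{f,\mathrm{id}_C}1_C$ and $1_A\Rightarrow_{\mathrm{id}_A,f}f_*$, and a conjoint $f^*\colon C\nrightarrow A$ with $f^*\Rightarrow_{\mathrm{id}_C,f}1_C$ and $1_A\Rightarrow_{f,\mathrm{id}_A}f^*$ (these are necessarily unique). A lax functor $F$ between thin equipments consists of a functor on the vertical categories together with an assignment $(J\colon A\nrightarrow B)\mapsto(FJ\colon FA\nrightarrow FB)$ such that $1_{FA}\le F1_A$, $FJ\odot FH\le F(J\odot H)$, and $J\Rightarrow_{f,g}K$ implies $FJ\Rightarrow_{Ff,Fg}FK$. It is normal if $F1_A=1_{FA}$ for all $A$ (then $F(f_* )=(Ff)_*$ and $F(f^* )=(Ff)^*$). A transformation $\xi\colon F\Rightarrow G$ of lax functors is a natural transformation between the vertical functors such that $FJ\Rightarrow_{\xi_A,\xi_B}GJ$ for every $J\colon A\nrightarrow B$. A lax monad $T=(T,\mu,\iota)$ on $\mathcal K$ is a lax functor $T\colon\mathcal K\to\mathcal K$ with transformations $\mu\colon T^2\Rightarrow T$ and $\iota\colon\mathrm{id}_{\mathcal K}\Rightarrow T$ satisfying the usual monad associativity and unit axioms; it is normal if its underlying lax functor is. A $T$-graph is an object $A$ with a horizontal morphism $\alpha\colon TA\nrightarrow A$ such that $1_A\Rightarrow_{\iota_A,\mathrm{id}_A}\alpha$. A $T$-morphism $f\colon(A,\alpha)\to(C,\gamma)$ is a vertical morphism $f\colon A\to C$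 with $\alpha\Rightarrow_{Tf,f}\gamma$. A horizontal morphism $J\colon A\nrightarrow B$ between $T$-graphs $(A,\alpha)$ and $(B,\beta)$ is $T$-open if $\alpha\odot J\le TJ\odot\beta$, and $T$-closed if $TJ\odot\beta\le\alpha\odot J$. A $T$-morphism $f\colon(A,\alpha)\to(C,\gamma)$ is $T$-open if its conjoint $f^*\colon C\nrightarrow A$ is $T$-open, i.e. $\gamma\odot f^*\le(Tf)^*\odot\alpha$. Given $d\colon A\to M$ and $J\colon A\nrightarrow B$, a vertical morphism $l\colon B\to M$ is the left Kan extension of $d$ along $J$ if $J\Rightarrow_{d,l}1_M$ and, for all $H\colon B\nrightarrow C$ and $g\colon C\to M$, $J\odot H\Rightarrow_{d,g}1_M$ implies $H\Rightarrow_{l,g}1_M$. It satisfies the Beck–Chevalley condition if $d^*\odot J=l^*$. *)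

theory Defs
  imports Main
begin

locale category =
  fixes Obj :: "'o set" and Arr :: "'a set"
    and Dom Cod :: "'a \<Rightarrow> 'o"
    and Id :: "'o \<Rightarrow> 'a"
    and Comp :: "'a \<Rightarrow> 'a \<Rightarrow> 'a"
  assumes Dom_in: "f \<in> Arr \<Longrightarrow> Dom f \<in> Obj"
    and Cod_in: "f \<in> Arr \<Longrightarrow> Cod f \<in> Obj"
    and Id_in: "A \<in> Obj \<Longrightarrow> Id A \<in> Arr"
    and Dom_Id: "A \<in> Obj \<Longrightarrow> Dom (Id A) = A"
    and Cod_Id: "A \<in> Obj \<Longrightarrow> Cod (Id A) = A"
    and Comp_in: "\<lbrakk>f \<in> Arr; g \<in> Arr; Dom g = Cod f\<rbrakk> \<Longrightarrow> Comp g f \<in> Arr"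
    and Dom_Comp: "\<lbrakk>f \<in> Arr; g \<in> Arr; Dom g = Cod f\<rbrakk> \<Longrightarrow> Dom (Comp g f) = Dom f"
    and Cod_Comp: "\<lbrakk>f \<in> Arr; g \<in> Arr; Dom g = Cod f\<rbrakk> \<Longrightarrow> Cod (Comp g f) = Cod g"
    and Comp_Id: "f \<in> Arr \<Longrightarrow> Comp f (Id (Dom f)) = f"
    and Id_Comp: "f \<in> Arr \<Longrightarrow> Comp (Id (Cod f)) f = f"
    and Comp_assoc: "\<lbrakk>f \<in> Arr; g \<in> Arr; h \<in> Arr; Dom g = Cod f; Dom h = Cod g\<rbrakk>
          \<Longrightarrow> Comp h (Comp g f) = Comp (Comp h g) f"

text \<open>A cell is determined by its boundary, so cells are given by a relation:
  \<open>cell K J f g L\<close> stands for the existence of the cell with top \<open>J\<close>, left side \<open>f\<close>,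
  right side \<open>g\<close> and bottom \<open>L\<close>.
  Vertical composition \<open>g \<circ> f\<close> is in applicative order, horizontal composition
  \<open>J \<odot> H\<close> in diagrammatic order.\<close>

record ('o, 'v, 'h) equipment =
  Ob :: "'o set"
  VArr :: "'v set"
  VDom :: "'v \<Rightarrow> 'o"
  VCod :: "'v \<Rightarrow> 'o"
  vid :: "'o \<Rightarrow> 'v"
  vcomp :: "'v \<Rightarrow> 'v \<Rightarrow> 'v" (infixl "\<cdot>\<index>" 70)
  HArr :: "'h set"
  HDom :: "'h \<Rightarrow> 'o"
  HCod :: "'h \<Rightarrow> 'o"
  hid :: "'o \<Rightarrow> 'h"
  hcomp :: "'h \<Rightarrow> 'h \<Rightarrow> 'h" (infixl "\<odot>\<index>" 70)
  cell :: "'h \<Rightarrow> 'v \<Rightarrow> 'v \<Rightarrow> 'h \<Rightarrow> bool"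

definition vert :: "('o, 'v, 'h) equipment \<Rightarrow> 'v \<Rightarrow> 'o \<Rightarrow> 'o \<Rightarrow> bool" where
  "vert K f A C \<longleftrightarrow> f \<in> VArr K \<and> VDom K f = A \<and> VCod K f = C"

definition horiz :: "('o, 'v, 'h) equipment \<Rightarrow> 'h \<Rightarrow> 'o \<Rightarrow> 'o \<Rightarrow> bool" where
  "horiz K J A B \<longleftrightarrow> J \<in> HArr K \<and> HDom K J = A \<and> HCod K J = B"

definition hle :: "('o, 'v, 'h) equipment \<Rightarrow> 'h \<Rightarrow> 'h \<Rightarrow> bool" where
  "hle K J L \<longleftrightarrow> cell K J (vid K (HDom K J)) (vid K (HCod K J)) L"

definition is_companion :: "('o, 'v, 'h) equipment \<Rightarrow> 'v \<Rightarrow> 'h \<Rightarrow> bool" where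
  "is_companion K f J \<longleftrightarrow>
     horiz K J (VDom K f) (VCod K f) \<and>
     cell K J f (vid K (VCod K f)) (hid K (VCod K f)) \<and>
     cell K (hid K (VDom K f)) (vid K (VDom K f)) f J"

definition is_conjoint :: "('o, 'v, 'h) equipment \<Rightarrow> 'v \<Rightarrow> 'h \<Rightarrow> bool" where
  "is_conjoint K f J \<longleftrightarrow>
     horiz K J (VCod K f) (VDom K f) \<and>
     cell K J (vid K (VCod K f)) f (hid K (VCod K f)) \<and>
     cell K (hid K (VDom K f)) f (vid K (VDom K f)) J"

locale thin_equipment =
  V: category "Ob K" "VArr K" "VDom K" "VCod K" "vid K" "vcomp K" +
  H: category "Ob K" "HArr K" "HDom K" "HCod K" "hid K" "\<lambda>H J. hcomp K J H"
  for K :: "('o, 'v, 'h) equipment" (structure) +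
  assumes cell_boundary: "cell K J f g L \<Longrightarrow>
            \<exists>A B C D. horiz K J A B \<and> horiz K L C D \<and> vert K f A C \<and> vert K g B D"
    and cell_vcomp: "\<lbrakk>cell K J f g L; cell K L h k N\<rbrakk> \<Longrightarrow> cell K J (h \<cdot> f) (k \<cdot> g) N"
    and cell_hcomp: "\<lbrakk>cell K J f g L; cell K H g l N\<rbrakk> \<Longrightarrow> cell K (J \<odot> H) f l (L \<odot> N)"
    and cell_hid: "f \<in> VArr K \<Longrightarrow> cell K (hid K (VDom K f)) f f (hid K (VCod K f))"
    and hle_refl: "J \<in> HArr K \<Longrightarrow> hle K J J"
    and hle_antisym: "\<lbrakk>hle K J L; hle K L J\<rbrakk> \<Longrightarrow> J = L"
    and companion_ex: "f \<in> VArr K \<Longrightarrow> \<exists>J. is_companion K f J"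
    and conjoint_ex: "f \<in> VArr K \<Longrightarrow> \<exists>J. is_conjoint K f J"

definition conjoint :: "('o, 'v, 'h) equipment \<Rightarrow> 'v \<Rightarrow> 'h" where
  "conjoint K f = (THE J. is_conjoint K f J)"

lemma (in thin_equipment) is_conjoint_unique:
  assumes "f \<in> VArr K" "is_conjoint K f J" "is_conjoint K f L"
  shows "J = L"
proof -
  have le: "hle K J L" if J: "is_conjoint K f J" and L: "is_conjoint K f L" for J L
  proof -
    have "cell K (J \<odot> hid K (VDom K f)) (vid K (VCod K f)) (vid K (VDom K f))
            (hid K (VCod K f) \<odot> L)"
      using J L unfolding is_conjoint_def by (blast intro: cell_hcomp)
    then show ?thesis
      using J L H.Comp_Id[of L] H.Id_Comp[of J]
      unfolding is_conjoint_def horiz_def hle_def by simp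
  qed
  show ?thesis using le assms hle_antisym by blast
qed

lemma (in thin_equipment) is_conjoint_conjoint:
  assumes "f \<in> VArr K"
  shows "is_conjoint K f (conjoint K f)"
  unfolding conjoint_def
  using conjoint_ex[OF assms] is_conjoint_unique[OF assms] by (metis theI)

record ('o, 'v, 'h, 'p, 'w, 'k) equipment_map =
  on_ob :: "'o \<Rightarrow> 'p"
  on_vert :: "'v \<Rightarrow> 'w"
  on_horiz :: "'h \<Rightarrow> 'k"

locale lax_functor =
  dom: thin_equipment K + cod: thin_equipment L
  for K :: "('o, 'v, 'h) equipment" and L :: "('p, 'w, 'k) equipment" +
  fixes F :: "('o, 'v, 'h, 'p, 'w, 'k) equipment_map"
  assumes on_ob_in: "A \<in> Ob K \<Longrightarrow> on_ob F A \<in> Ob L"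
    and vert_on_vert: "vert K f A C \<Longrightarrow> vert L (on_vert F f) (on_ob F A) (on_ob F C)"
    and on_vert_vid: "A \<in> Ob K \<Longrightarrow> on_vert F (vid K A) = vid L (on_ob F A)"
    and on_vert_vcomp: "\<lbrakk>vert K f A C; vert K g C E\<rbrakk>
          \<Longrightarrow> on_vert F (g \<cdot>\<^bsub>K\<^esub> f) = on_vert F g \<cdot>\<^bsub>L\<^esub> on_vert F f"
    and horiz_on_horiz: "horiz K J A B \<Longrightarrow> horiz L (on_horiz F J) (on_ob F A) (on_ob F B)"
    and lax_unit: "A \<in> Ob K \<Longrightarrow> hle L (hid L (on_ob F A)) (on_horiz F (hid K A))"
    and lax_hcomp: "\<lbrakk>horiz K J A B; horiz K H B E\<rbrakk>
          \<Longrightarrow> hle L (on_horiz F J \<odot>\<^bsub>L\<^esub> on_horiz F H) (on_horiz F (J \<odot>\<^bsub>K\<^esub> H))"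
    and on_cell: "cell K J f g N
          \<Longrightarrow> cell L (on_horiz F J) (on_vert F f) (on_vert F g) (on_horiz F N)"

definition normal_map ::
  "('o, 'v, 'h) equipment \<Rightarrow> ('p, 'w, 'k) equipment \<Rightarrow>
   ('o, 'v, 'h, 'p, 'w, 'k) equipment_map \<Rightarrow> bool" where
  "normal_map K L F \<longleftrightarrow> (\<forall>A\<in>Ob K. on_horiz F (hid K A) = hid L (on_ob F A))"

definition id_map :: "('o, 'v, 'h, 'o, 'v, 'h) equipment_map" where
  "id_map = \<lparr>on_ob = id, on_vert = id, on_horiz = id\<rparr>"

definition comp_map ::
  "('p, 'w, 'k, 'q, 'x, 'l) equipment_map \<Rightarrow> ('o, 'v, 'h, 'p, 'w, 'k) equipment_map \<Rightarrow>
   ('o, 'v, 'h, 'q, 'x, 'l) equipment_map" where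
  "comp_map G F = \<lparr>on_ob = on_ob G \<circ> on_ob F, on_vert = on_vert G \<circ> on_vert F,
                   on_horiz = on_horiz G \<circ> on_horiz F\<rparr>"

locale transformation =
  source: lax_functor K L F + target: lax_functor K L G
  for K :: "('o, 'v, 'h) equipment" and L :: "('p, 'w, 'k) equipment"
    and F G :: "('o, 'v, 'h, 'p, 'w, 'k) equipment_map" +
  fixes \<xi> :: "'o \<Rightarrow> 'w"
  assumes component: "A \<in> Ob K \<Longrightarrow> vert L (\<xi> A) (on_ob F A) (on_ob G A)"
    and natural: "vert K f A C \<Longrightarrow> \<xi> C \<cdot>\<^bsub>L\<^esub> on_vert F f = on_vert G f \<cdot>\<^bsub>L\<^esub> \<xi> A"
    and cell_component: "horiz K J A B \<Longrightarrow> cell L (on_horiz F J) (\<xi> A) (\<xi> B) (on_horiz G J)"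

locale lax_monad =
  endo: lax_functor K K T +
  mult: transformation K K "comp_map T T" T \<mu> +
  unit: transformation K K id_map T \<iota>
  for K :: "('o, 'v, 'h) equipment"
    and T :: "('o, 'v, 'h, 'o, 'v, 'h) equipment_map"
    and \<mu> \<iota> :: "'o \<Rightarrow> 'v" +
  assumes mult_assoc: "A \<in> Ob K \<Longrightarrow>
            \<mu> A \<cdot>\<^bsub>K\<^esub> on_vert T (\<mu> A) = \<mu> A \<cdot>\<^bsub>K\<^esub> \<mu> (on_ob T A)"
    and mult_unit_left: "A \<in> Ob K \<Longrightarrow> \<mu> A \<cdot>\<^bsub>K\<^esub> \<iota> (on_ob T A) = vid K (on_ob T A)"
    and mult_unit_right: "A \<in> Ob K \<Longrightarrow> \<mu> A \<cdot>\<^bsub>K\<^esub> on_vert T (\<iota> A) = vid K (on_ob T A)"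

locale normal_lax_monad = lax_monad +
  assumes normal: "normal_map K K T"

text \<open>The locales above take the laxness of \<open>id_map\<close> and \<open>comp_map T T\<close> as assumptions;
  \<open>lax_functor_id_map\<close> and \<open>lax_functor_comp_map\<close> below show that these assumptions are redundant.\<close>

lemma lax_functor_id_map:
  assumes "thin_equipment K"
  shows "lax_functor K K id_map"
proof -
  interpret thin_equipment K by fact
  show ?thesis
  proof unfold_locales
    fix J A B H E
    assume *: "horiz K J A B" "horiz K H B E"
    then have "J \<odot>\<^bsub>K\<^esub> H \<in> HArr K" unfolding horiz_def by (auto intro: H.Comp_in)
    then show "hle K (on_horiz id_map J \<odot>\<^bsub>K\<^esub> on_horiz id_map H) (on_horiz id_map (J \<odot>\<^bsub>K\<^esub> H))"
      by (simp add: id_map_def hle_refl)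
  qed (auto simp: id_map_def hle_refl H.Id_in)
qed

lemma (in lax_functor) on_hle:
  assumes "hle K J N"
  shows "hle L (on_horiz F J) (on_horiz F N)"
proof -
  from assms obtain A B where J: "horiz K J A B"
    unfolding hle_def using dom.cell_boundary by blast
  then have "A \<in> Ob K" "B \<in> Ob K" unfolding horiz_def using dom.H.Dom_in dom.H.Cod_in by auto
  then show ?thesis
    using on_cell[OF assms[unfolded hle_def]] J horiz_on_horiz[OF J]
    by (simp add: hle_def horiz_def on_vert_vid)
qed

lemma (in thin_equipment) hle_trans:
  assumes "hle K J L" "hle K L N"
  shows "hle K J N"
proof -
  from assms obtain A B where J: "horiz K J A B" unfolding hle_def using cell_boundary by blast
  from assms obtain C D where L: "horiz K L C D" unfolding hle_def using cell_boundary by blast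
  have AB: "A \<in> Ob K" "B \<in> Ob K" using J unfolding horiz_def using H.Dom_in H.Cod_in by auto
  have "C = A" "D = B"
    using cell_boundary[OF assms(1)[unfolded hle_def]] J L AB
    by (auto simp: horiz_def vert_def V.Dom_Id V.Cod_Id)
  then show ?thesis
    using cell_vcomp[OF assms[unfolded hle_def]] J L AB
      V.Comp_Id[OF V.Id_in[OF AB(1)]] V.Comp_Id[OF V.Id_in[OF AB(2)]]
    by (simp add: hle_def horiz_def V.Dom_Id)
qed

lemma lax_functor_comp_map:
  assumes "lax_functor K L F" "lax_functor L M G"
  shows "lax_functor K M (comp_map G F)"
proof -
  interpret F: lax_functor K L F by fact
  interpret G: lax_functor L M G by fact
  show ?thesis
  proof unfold_locales
    fix A assume "A \<in> Ob K"
    then show "hle M (hid M (on_ob (comp_map G F) A)) (on_horiz (comp_map G F) (hid K A))"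
      using G.lax_unit[OF F.on_ob_in] G.on_hle[OF F.lax_unit] G.cod.hle_trans
      by (simp add: comp_map_def) blast
  next
    fix J A B H E assume "horiz K J A B" "horiz K H B E"
    then show "hle M (on_horiz (comp_map G F) J \<odot>\<^bsub>M\<^esub> on_horiz (comp_map G F) H)
                 (on_horiz (comp_map G F) (J \<odot>\<^bsub>K\<^esub> H))"
      using G.lax_hcomp[OF F.horiz_on_horiz F.horiz_on_horiz] G.on_hle[OF F.lax_hcomp]
        G.cod.hle_trans
      by (simp add: comp_map_def) blast
  next
    fix f A C g E assume "vert K f A C" "vert K g C E"
    then show "on_vert (comp_map G F) (g \<cdot>\<^bsub>K\<^esub> f)
                 = on_vert (comp_map G F) g \<cdot>\<^bsub>M\<^esub> on_vert (comp_map G F) f"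
      using G.on_vert_vcomp[OF F.vert_on_vert F.vert_on_vert] F.on_vert_vcomp
      by (simp add: comp_map_def)
  qed (auto simp: comp_map_def F.on_ob_in G.on_ob_in F.on_vert_vid G.on_vert_vid
         intro: F.vert_on_vert G.vert_on_vert F.horiz_on_horiz G.horiz_on_horiz
           F.on_cell G.on_cell)
qed

definition T_graph ::
  "('o, 'v, 'h) equipment \<Rightarrow> ('o, 'v, 'h, 'o, 'v, 'h) equipment_map \<Rightarrow> ('o \<Rightarrow> 'v) \<Rightarrow>
   'o \<Rightarrow> 'h \<Rightarrow> bool" where
  "T_graph K T \<iota> A \<alpha> \<longleftrightarrow>
     A \<in> Ob K \<and> horiz K \<alpha> (on_ob T A) A \<and> cell K (hid K A) (\<iota> A) (vid K A) \<alpha>"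

definition T_morphism ::
  "('o, 'v, 'h) equipment \<Rightarrow> ('o, 'v, 'h, 'o, 'v, 'h) equipment_map \<Rightarrow>
   'o \<Rightarrow> 'h \<Rightarrow> 'o \<Rightarrow> 'h \<Rightarrow> 'v \<Rightarrow> bool" where
  "T_morphism K T A \<alpha> C \<gamma> f \<longleftrightarrow> vert K f A C \<and> cell K \<alpha> (on_vert T f) f \<gamma>"

definition T_open ::
  "('o, 'v, 'h) equipment \<Rightarrow> ('o, 'v, 'h, 'o, 'v, 'h) equipment_map \<Rightarrow>
   'o \<Rightarrow> 'h \<Rightarrow> 'o \<Rightarrow> 'h \<Rightarrow> 'h \<Rightarrow> bool" where
  "T_open K T A \<alpha> B \<beta> J \<longleftrightarrow>
     horiz K J A B \<and> hle K (\<alpha> \<odot>\<^bsub>K\<^esub> J) (on_horiz T J \<odot>\<^bsub>K\<^esub> \<beta>)"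

definition T_closed ::
  "('o, 'v, 'h) equipment \<Rightarrow> ('o, 'v, 'h, 'o, 'v, 'h) equipment_map \<Rightarrow>
   'o \<Rightarrow> 'h \<Rightarrow> 'o \<Rightarrow> 'h \<Rightarrow> 'h \<Rightarrow> bool" where
  "T_closed K T A \<alpha> B \<beta> J \<longleftrightarrow>
     horiz K J A B \<and> hle K (on_horiz T J \<odot>\<^bsub>K\<^esub> \<beta>) (\<alpha> \<odot>\<^bsub>K\<^esub> J)"

definition T_open_morphism ::
  "('o, 'v, 'h) equipment \<Rightarrow> ('o, 'v, 'h, 'o, 'v, 'h) equipment_map \<Rightarrow>
   'o \<Rightarrow> 'h \<Rightarrow> 'o \<Rightarrow> 'h \<Rightarrow> 'v \<Rightarrow> bool" where
  "T_open_morphism K T A \<alpha> C \<gamma> f \<longleftrightarrow>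
     T_morphism K T A \<alpha> C \<gamma> f \<and> T_open K T C \<gamma> A \<alpha> (conjoint K f)"

definition left_Kan_extension ::
  "('o, 'v, 'h) equipment \<Rightarrow> 'o \<Rightarrow> 'o \<Rightarrow> 'o \<Rightarrow> 'v \<Rightarrow> 'h \<Rightarrow> 'v \<Rightarrow> bool" where
  "left_Kan_extension K A B M d J l \<longleftrightarrow>
     vert K d A M \<and> horiz K J A B \<and> vert K l B M \<and>
     cell K J d l (hid K M) \<and>
     (\<forall>C H g. horiz K H B C \<longrightarrow> vert K g C M \<longrightarrow>
        cell K (J \<odot>\<^bsub>K\<^esub> H) d g (hid K M) \<longrightarrow> cell K H l g (hid K M))"

definition Beck_Chevalley :: "('o, 'v, 'h) equipment \<Rightarrow> 'v \<Rightarrow> 'h \<Rightarrow> 'v \<Rightarrow> bool" where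
  "Beck_Chevalley K d J l \<longleftrightarrow> conjoint K d \<odot>\<^bsub>K\<^esub> J = conjoint K l"

end

theory Submission
  imports Defs
begin

text \<open>
  In a thin equipment vertical morphisms can be traded for their conjoints: a cell from \<open>J\<close> to
  \<open>L\<close> with sides \<open>f\<close> and \<open>g\<close> is the same thing as an inequality \<open>f\<^sup>* \<odot> J \<le> L \<odot> g\<^sup>*\<close> of
  horizontal morphisms (\<open>cell_iff_conjoint_hle\<close>). As a normal lax functor preserves conjoints
  (\<open>on_horiz_conjoint\<close>), being a \<open>T\<close>-morphism \<open>l: (B, \<beta>) \<rightarrow> (M, \<zeta>)\<close> means
  \<open>T(l\<^sup>*) \<odot> \<beta> \<le> \<zeta> \<odot> l\<^sup>*\<close>, that is, \<open>l\<^sup>*\<close> is \<open>T\<close>-closed; being \<open>T\<close>-open means the reverse inequality.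

  Hence everything reduces to the horizontal morphism \<open>l\<^sup>*\<close>, which the Beck--Chevalley condition
  identifies with \<open>d\<^sup>* \<odot> J\<close>. A composite of two \<open>T\<close>-closed morphisms \<open>J\<close> and \<open>H\<close> is \<open>T\<close>-closed
  when \<open>T\<close> preserves it strictly: \<open>TJ \<odot> TH \<odot> \<gamma> \<le> TJ \<odot> \<beta> \<odot> H \<le> \<alpha> \<odot> J \<odot> H\<close>. For \<open>T\<close>-open
  morphisms the same chain runs backwards. Both facts are applied to \<open>d\<^sup>*\<close> and \<open>J\<close>.
\<close>

context thin_equipment
begin

lemma horiz_hcomp: "\<lbrakk>horiz K J A B; horiz K H B C\<rbrakk> \<Longrightarrow> horiz K (J \<odot> H) A C"
  unfolding horiz_def by (simp add: H.Comp_in H.Dom_Comp H.Cod_Comp)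

lemma hcomp_assoc:
  "\<lbrakk>horiz K J A B; horiz K H B C; horiz K N C E\<rbrakk> \<Longrightarrow> (J \<odot> H) \<odot> N = J \<odot> (H \<odot> N)"
  unfolding horiz_def by (simp add: H.Comp_assoc)

lemma hid_hcomp: "horiz K J A B \<Longrightarrow> hid K A \<odot> J = J"
  and hcomp_hid: "horiz K J A B \<Longrightarrow> J \<odot> hid K B = J"
  unfolding horiz_def using H.Comp_Id H.Id_Comp by auto

lemma hle_iff_cell: "horiz K J A B \<Longrightarrow> hle K J L \<longleftrightarrow> cell K J (vid K A) (vid K B) L"
  unfolding hle_def horiz_def by simp

lemma hle_hcomp:
  assumes "hle K J J'" "hle K H H'" "horiz K J A B" "horiz K H B C"
  shows "hle K (J \<odot> H) (J' \<odot> H')"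
  using cell_hcomp[OF assms(1)[unfolded hle_iff_cell[OF assms(3)]]
      assms(2)[unfolded hle_iff_cell[OF assms(4)]]]
  unfolding hle_iff_cell[OF horiz_hcomp[OF assms(3,4)]] .

lemma horiz_conjoint: "vert K f A C \<Longrightarrow> horiz K (conjoint K f) C A"
  and conjoint_counit: "vert K f A C \<Longrightarrow> cell K (conjoint K f) (vid K C) f (hid K C)"
  and conjoint_unit: "vert K f A C \<Longrightarrow> cell K (hid K A) f (vid K A) (conjoint K f)"
  using is_conjoint_conjoint unfolding vert_def is_conjoint_def by auto

lemma vcomp_vid: "vert K f A C \<Longrightarrow> f \<cdot> vid K A = f"
  and vid_vcomp: "vert K f A C \<Longrightarrow> vid K C \<cdot> f = f"
  unfolding vert_def using V.Comp_Id V.Id_Comp by auto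

lemma vert_vid: "A \<in> Ob K \<Longrightarrow> vert K (vid K A) A A"
  using V.Id_in V.Dom_Id V.Cod_Id unfolding vert_def by blast

lemma vert_Ob: "vert K f A C \<Longrightarrow> A \<in> Ob K \<and> C \<in> Ob K"
  using V.Dom_in V.Cod_in unfolding vert_def by blast

text \<open>Pasting the counit cell of \<open>f\<^sup>*\<close> on the left and the unit cell of \<open>g\<^sup>*\<close> on the right turns a
  cell with sides \<open>f\<close> and \<open>g\<close> into one with identity sides; pasting the other two cells, above and
  below, reverses this.\<close>

lemma cell_iff_conjoint_hle:
  assumes f: "vert K f A C" and g: "vert K g B D"
    and J: "horiz K J A B" and L: "horiz K L C D"
  shows "cell K J f g L \<longleftrightarrow> hle K (conjoint K f \<odot> J) (L \<odot> conjoint K g)"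
proof
  note fJ = horiz_hcomp[OF horiz_conjoint[OF f] J]
  assume "cell K J f g L"
  then have "cell K (conjoint K f \<odot> J \<odot> hid K B) (vid K C) (vid K B)
               (hid K C \<odot> L \<odot> conjoint K g)"
    by (intro cell_hcomp[OF cell_hcomp[OF conjoint_counit[OF f]] conjoint_unit[OF g]])
  then show "hle K (conjoint K f \<odot> J) (L \<odot> conjoint K g)"
    by (simp add: hle_iff_cell[OF fJ] hcomp_hid[OF fJ] hid_hcomp[OF L])
next
  note Lg = horiz_hcomp[OF L horiz_conjoint[OF g]]
  note fJ = horiz_hcomp[OF horiz_conjoint[OF f] J]
  assume le: "hle K (conjoint K f \<odot> J) (L \<odot> conjoint K g)"
  have "cell K J (vid K A) (vid K B) J"
    using hle_refl J hle_iff_cell[OF J] unfolding horiz_def by blast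
  then have above: "cell K J f (vid K B) (conjoint K f \<odot> J)"
    using cell_hcomp[OF conjoint_unit[OF f]] by (fastforce simp: hid_hcomp[OF J])
  have "cell K L (vid K C) (vid K D) L"
    using hle_refl L hle_iff_cell[OF L] unfolding horiz_def by blast
  then have below: "cell K (L \<odot> conjoint K g) (vid K C) g L"
    using cell_hcomp[OF _ conjoint_counit[OF g]] by (fastforce simp: hcomp_hid[OF L])
  have "cell K J (vid K C \<cdot> (vid K C \<cdot> f)) (g \<cdot> (vid K B \<cdot> vid K B)) L"
    using cell_vcomp[OF cell_vcomp[OF above le[unfolded hle_iff_cell[OF fJ]]] below] .
  then show "cell K J f g L"
    using vert_Ob[OF g] by (simp add: vid_vcomp[OF f] vcomp_vid[OF g] vcomp_vid[OF vert_vid])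
qed

end

text \<open>The image under a normal functor of the two cells defining \<open>f\<^sup>*\<close> are the two cells defining
  \<open>(Ff)\<^sup>*\<close>, since normality fixes their horizontal identities; conjoints are unique.\<close>

lemma (in lax_functor) on_horiz_conjoint:
  assumes normal: "normal_map K L F" and f: "vert K f A C"
  shows "on_horiz F (conjoint K f) = conjoint L (on_vert F f)"
proof -
  have Ff: "vert L (on_vert F f) (on_ob F A) (on_ob F C)"
    using vert_on_vert[OF f] .
  have "is_conjoint L (on_vert F f) (on_horiz F (conjoint K f))"
    using horiz_on_horiz[OF dom.horiz_conjoint[OF f]] on_cell[OF dom.conjoint_counit[OF f]]
      on_cell[OF dom.conjoint_unit[OF f]] Ff normal dom.vert_Ob[OF f]
    by (simp add: is_conjoint_def vert_def normal_map_def on_vert_vid)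
  then show ?thesis
    using cod.is_conjoint_unique cod.is_conjoint_conjoint Ff unfolding vert_def by blast
qed

text \<open>Through the conjoint, the structure cell of a \<open>T\<close>-morphism becomes a closedness inequality.\<close>

lemma T_morphism_iff_T_closed_conjoint:
  assumes T: "lax_functor K K T" "normal_map K K T"
    and f: "vert K f A C" and \<alpha>: "horiz K \<alpha> (on_ob T A) A" and \<gamma>: "horiz K \<gamma> (on_ob T C) C"
  shows "T_morphism K T A \<alpha> C \<gamma> f \<longleftrightarrow> T_closed K T C \<gamma> A \<alpha> (conjoint K f)"
proof -
  interpret T: lax_functor K K T by fact
  show ?thesis
    unfolding T_morphism_def T_closed_def
    using T.dom.cell_iff_conjoint_hle[OF T.vert_on_vert[OF f] f \<alpha> \<gamma>]
      T.on_horiz_conjoint[OF T(2) f] T.dom.horiz_conjoint[OF f] f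
    by simp
qed

lemma T_closed_hcomp:
  assumes T: "lax_functor K K T"
    and \<alpha>: "horiz K \<alpha> (on_ob T A) A" and \<beta>: "horiz K \<beta> (on_ob T B) B"
    and \<gamma>: "horiz K \<gamma> (on_ob T C) C"
    and J: "T_closed K T A \<alpha> B \<beta> J" and H: "T_closed K T B \<beta> C \<gamma> H"
    and strict: "on_horiz T J \<odot>\<^bsub>K\<^esub> on_horiz T H = on_horiz T (J \<odot>\<^bsub>K\<^esub> H)"
  shows "T_closed K T A \<alpha> C \<gamma> (J \<odot>\<^bsub>K\<^esub> H)"
proof -
  interpret T: lax_functor K K T by fact
  note hc = T.dom.horiz_hcomp
  have hJ: "horiz K J A B" and hH: "horiz K H B C"
    using J H unfolding T_closed_def by auto
  note TJ = T.horiz_on_horiz[OF hJ] and TH = T.horiz_on_horiz[OF hH]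
  have refl: "hle K (on_horiz T J) (on_horiz T J)" "hle K H H"
    using T.dom.hle_refl TJ hH unfolding horiz_def by auto
  have "hle K (on_horiz T J \<odot>\<^bsub>K\<^esub> (on_horiz T H \<odot>\<^bsub>K\<^esub> \<gamma>)) (on_horiz T J \<odot>\<^bsub>K\<^esub> (\<beta> \<odot>\<^bsub>K\<^esub> H))"
    using T.dom.hle_hcomp[OF refl(1) _ TJ hc[OF TH \<gamma>]] H unfolding T_closed_def by blast
  moreover have "hle K (on_horiz T J \<odot>\<^bsub>K\<^esub> \<beta> \<odot>\<^bsub>K\<^esub> H) (\<alpha> \<odot>\<^bsub>K\<^esub> J \<odot>\<^bsub>K\<^esub> H)"
    using T.dom.hle_hcomp[OF _ refl(2) hc[OF TJ \<beta>] hH] J unfolding T_closed_def by blast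
  ultimately have "hle K (on_horiz T J \<odot>\<^bsub>K\<^esub> on_horiz T H \<odot>\<^bsub>K\<^esub> \<gamma>) (\<alpha> \<odot>\<^bsub>K\<^esub> (J \<odot>\<^bsub>K\<^esub> H))"
    using T.dom.hcomp_assoc[OF TJ TH \<gamma>] T.dom.hcomp_assoc[OF TJ \<beta> hH]
      T.dom.hcomp_assoc[OF \<alpha> hJ hH]
    by (auto intro: T.dom.hle_trans)
  then show ?thesis
    unfolding T_closed_def using hc[OF hJ hH] strict by simp
qed

text \<open>The chain \<open>\<alpha> \<odot> J \<odot> H \<le> TJ \<odot> \<beta> \<odot> H \<le> TJ \<odot> TH \<odot> \<gamma>\<close> is completed by the lax comparison
  \<open>TJ \<odot> TH \<le> T(J \<odot> H)\<close>, which points in the direction that openness requires.\<close>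

lemma T_open_hcomp:
  assumes T: "lax_functor K K T"
    and \<alpha>: "horiz K \<alpha> (on_ob T A) A" and \<beta>: "horiz K \<beta> (on_ob T B) B"
    and \<gamma>: "horiz K \<gamma> (on_ob T C) C"
    and J: "T_open K T A \<alpha> B \<beta> J" and H: "T_open K T B \<beta> C \<gamma> H"
  shows "T_open K T A \<alpha> C \<gamma> (J \<odot>\<^bsub>K\<^esub> H)"
proof -
  interpret T: lax_functor K K T by fact
  note hc = T.dom.horiz_hcomp
  have hJ: "horiz K J A B" and hH: "horiz K H B C"
    using J H unfolding T_open_def by auto
  note TJ = T.horiz_on_horiz[OF hJ] and TH = T.horiz_on_horiz[OF hH]
  have refl: "hle K (on_horiz T J) (on_horiz T J)" "hle K H H" "hle K \<gamma> \<gamma>"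
    using T.dom.hle_refl TJ hH \<gamma> unfolding horiz_def by auto
  have "hle K (\<alpha> \<odot>\<^bsub>K\<^esub> J \<odot>\<^bsub>K\<^esub> H) (on_horiz T J \<odot>\<^bsub>K\<^esub> \<beta> \<odot>\<^bsub>K\<^esub> H)"
    using T.dom.hle_hcomp[OF _ refl(2) hc[OF \<alpha> hJ] hH] J unfolding T_open_def by blast
  moreover have "hle K (on_horiz T J \<odot>\<^bsub>K\<^esub> (\<beta> \<odot>\<^bsub>K\<^esub> H)) (on_horiz T J \<odot>\<^bsub>K\<^esub> (on_horiz T H \<odot>\<^bsub>K\<^esub> \<gamma>))"
    using T.dom.hle_hcomp[OF refl(1) _ TJ hc[OF \<beta> hH]] H unfolding T_open_def by blast
  moreover have "hle K (on_horiz T J \<odot>\<^bsub>K\<^esub> on_horiz T H \<odot>\<^bsub>K\<^esub> \<gamma>) (on_horiz T (J \<odot>\<^bsub>K\<^esub> H) \<odot>\<^bsub>K\<^esub> \<gamma>)"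
    using T.dom.hle_hcomp[OF T.lax_hcomp[OF hJ hH] refl(3) hc[OF TJ TH] \<gamma>] .
  ultimately have "hle K (\<alpha> \<odot>\<^bsub>K\<^esub> (J \<odot>\<^bsub>K\<^esub> H)) (on_horiz T (J \<odot>\<^bsub>K\<^esub> H) \<odot>\<^bsub>K\<^esub> \<gamma>)"
    using T.dom.hcomp_assoc[OF TJ TH \<gamma>] T.dom.hcomp_assoc[OF TJ \<beta> hH]
      T.dom.hcomp_assoc[OF \<alpha> hJ hH]
    by (auto intro: T.dom.hle_trans)
  then show ?thesis
    unfolding T_open_def using hc[OF hJ hH] by simp
qed

theorem theorem7p9:
  fixes K :: "('o, 'v, 'h) equipment"
    and T :: "('o, 'v, 'h, 'o, 'v, 'h) equipment_map"
    and \<mu> \<iota> :: "'o \<Rightarrow> 'v"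
    and A B M :: 'o and \<alpha> \<beta> \<zeta> J :: 'h and d l :: 'v
  assumes "normal_lax_monad K T \<mu> \<iota>"
    and "T_graph K T \<iota> A \<alpha>" and "T_graph K T \<iota> B \<beta>" and "T_graph K T \<iota> M \<zeta>"
    and "T_morphism K T A \<alpha> M \<zeta> d"
    and "T_closed K T A \<alpha> B \<beta> J"
    and "left_Kan_extension K A B M d J l"
    and "Beck_Chevalley K d J l"
    and "on_horiz T (conjoint K d) \<odot>\<^bsub>K\<^esub> on_horiz T J = on_horiz T (conjoint K d \<odot>\<^bsub>K\<^esub> J)"
  shows "T_morphism K T B \<beta> M \<zeta> l \<and>
         (T_open_morphism K T A \<alpha> M \<zeta> d \<and> T_open K T A \<alpha> B \<beta> J
            \<longrightarrow> T_open_morphism K T B \<beta> M \<zeta> l)"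
proof -
  interpret normal_lax_monad K T \<mu> \<iota> by fact
  have T: "lax_functor K K T" "normal_map K K T"
    by (rule endo.lax_functor_axioms normal)+
  have \<alpha>: "horiz K \<alpha> (on_ob T A) A" and \<beta>: "horiz K \<beta> (on_ob T B) B"
    and \<zeta>: "horiz K \<zeta> (on_ob T M) M"
    using assms(2-4) unfolding T_graph_def by auto
  have d: "vert K d A M" and l: "vert K l B M"
    using assms(7) unfolding left_Kan_extension_def by auto
  have BC: "conjoint K d \<odot>\<^bsub>K\<^esub> J = conjoint K l"
    using assms(8) unfolding Beck_Chevalley_def .
  have "T_closed K T M \<zeta> A \<alpha> (conjoint K d)"
    using T_morphism_iff_T_closed_conjoint[OF T d \<alpha> \<zeta>] assms(5) by blast
  then have "T_closed K T M \<zeta> B \<beta> (conjoint K l)"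
    using T_closed_hcomp[OF T(1) \<zeta> \<alpha> \<beta> _ assms(6,9)] BC by simp
  then have mor: "T_morphism K T B \<beta> M \<zeta> l"
    using T_morphism_iff_T_closed_conjoint[OF T l \<beta> \<zeta>] by blast
  have "T_open K T M \<zeta> B \<beta> (conjoint K l)"
    if "T_open_morphism K T A \<alpha> M \<zeta> d" "T_open K T A \<alpha> B \<beta> J"
    using T_open_hcomp[OF T(1) \<zeta> \<alpha> \<beta> that(1)[unfolded T_open_morphism_def, THEN conjunct2] that(2)]
    unfolding BC .
  with mor show ?thesis
    unfolding T_open_morphism_def by blast
qed

end
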